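(* Let $\mathbb{k}$ be an algebraically closed field of characteristic $p>0$, let $k \geq 3$ be an integer, and let $L$ be the Lie algebra over $\mathbb{k}$ with basis $x_1, x_2, \ldots, x_k, D_0, D$ (so $\dim L = k+2$) whose bracket is determined by: $D_0$ is central; $[x_i,x_j]=0$ for all $i,j \in \{1,\ldots,k\}$; $[D,x_i]=x_i$ for $i=1,\ldots,k-2$; $[D,x_{k-1}]=x_k$; and $[D,x_k]=0$. Then $p^2$ divides $M(L)$ and $\operatorname{ind} L = k$, so that $$M(L) \neq p^{\frac{1}{2}(\dim L - \operatorname{ind} L)}.$$
   Context: For a finite dimensional Lie algebra $L$ over an algebraically closed field $\mathbb{k}$ of characteristic $p>0$, all simple $L$-modules are finite dimensional and their dimensions are uniformly bounded above; $M(L)$ denotes the least upper bound (maximum) of the dimensions of simple $L$-modules. For $\chi \in L^*$, $L_\chi = \{X \in L : \chi([X,Y]) = 0 \text{ for all } Y \in L\}$ denotes the stabiliser of $\chi$ in the coadjoint representation. The index of $L$ is $\operatorname{ind} L = \min_{\chi \in L^*} \dim L_\chi$. *)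

theory Defs
  imports Complex_Main "HOL-Computational_Algebra.Computational_Algebra"
    "HOL-Library.Function_Algebras"
begin

locale lie_algebra = vector_space scale
  for scale :: "'k::field \<Rightarrow> 'l::ab_group_add \<Rightarrow> 'l" +
  fixes bracket :: "'l \<Rightarrow> 'l \<Rightarrow> 'l"
  assumes bracket_add_left: "bracket (x + y) z = bracket x z + bracket y z"
    and bracket_add_right: "bracket x (y + z) = bracket x y + bracket x z"
    and bracket_scale_left: "bracket (scale c x) y = scale c (bracket x y)"
    and bracket_scale_right: "bracket x (scale c y) = scale c (bracket x y)"
    and bracket_self: "bracket x x = 0"
    and jacobi: "bracket x (bracket y z) + bracket y (bracket z x) + bracket z (bracket x y) = 0"
begin

definition dual_space :: "('l \<Rightarrow> 'k) set" where
  "dual_space = {\<chi>. Vector_Spaces.linear scale (*) \<chi>}"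

definition stabiliser :: "('l \<Rightarrow> 'k) \<Rightarrow> 'l set" where
  "stabiliser \<chi> = {X. \<forall>Y. \<chi> (bracket X Y) = 0}"

(* Meaningful for a finite dimensional Lie algebra: the dimensions then form a
   finite nonempty set of naturals. *)
definition ind :: nat where
  "ind = Min ((\<lambda>\<chi>. dim (stabiliser \<chi>)) ` dual_space)"

end

(* The module is a subspace V of an ambient vector space; the action is only
   constrained on V. *)
locale lie_module = L: lie_algebra scale bracket + M: vector_space scaleV
  for scale :: "'k::field \<Rightarrow> 'l::ab_group_add \<Rightarrow> 'l"
    and bracket :: "'l \<Rightarrow> 'l \<Rightarrow> 'l"
    and scaleV :: "'k \<Rightarrow> 'v::ab_group_add \<Rightarrow> 'v" +
  fixes V :: "'v set"
    and act :: "'l \<Rightarrow> 'v \<Rightarrow> 'v"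
  assumes subspace_V: "M.subspace V"
    and act_closed: "v \<in> V \<Longrightarrow> act x v \<in> V"
    and act_add_left: "v \<in> V \<Longrightarrow> act (x + y) v = act x v + act y v"
    and act_scale_left: "v \<in> V \<Longrightarrow> act (scale c x) v = scaleV c (act x v)"
    and act_add_right: "v \<in> V \<Longrightarrow> w \<in> V \<Longrightarrow> act x (v + w) = act x v + act x w"
    and act_scale_right: "v \<in> V \<Longrightarrow> act x (scaleV c v) = scaleV c (act x v)"
    and act_bracket: "v \<in> V \<Longrightarrow> act (bracket x y) v = act x (act y v) - act y (act x v)"

locale simple_lie_module = lie_module +
  assumes nonzero: "V \<noteq> {0}"
    and submodule_trivial:
      "M.subspace W \<Longrightarrow> W \<subseteq> V \<Longrightarrow> (\<And>x w. w \<in> W \<Longrightarrow> act x w \<in> W) \<Longrightarrow> W = {0} \<or> W = V"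

definition coord_scale :: "'k::field \<Rightarrow> (nat \<Rightarrow> 'k) \<Rightarrow> (nat \<Rightarrow> 'k)" where
  "coord_scale c f = (\<lambda>i. c * f i)"

lemma vector_space_coord_scale: "vector_space coord_scale"
  by unfold_locales (auto simp: coord_scale_def algebra_simps)

(* HOL cannot quantify over modules in all types, so modules are taken inside the
   space of sequences, which contains a copy of every vector space of countable
   dimension, in particular of every finite dimensional one. The finiteness clause
   in simple_module_dims is there because dim is 0 on infinite dimensional spaces;
   it excludes nothing when L is finite dimensional in characteristic p > 0, as all
   simple L-modules are then finite dimensional. *)
definition simple_module_dims ::
    "('k::field \<Rightarrow> 'l::ab_group_add \<Rightarrow> 'l) \<Rightarrow> ('l \<Rightarrow> 'l \<Rightarrow> 'l) \<Rightarrow> nat set" where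
  "simple_module_dims scale bracket =
     {vector_space.dim coord_scale V | V act.
        simple_lie_module scale bracket coord_scale V act \<and>
        (\<exists>B. finite B \<and> module.span coord_scale B = V)}"

definition max_simple_dim ::
    "('k::field \<Rightarrow> 'l::ab_group_add \<Rightarrow> 'l) \<Rightarrow> ('l \<Rightarrow> 'l \<Rightarrow> 'l) \<Rightarrow> nat" where
  "max_simple_dim scale bracket = Max (simple_module_dims scale bracket)"

end

theory Submission
  imports Defs
begin

text \<open>
  In a simple module, let v be a common eigenvector of the commuting elements
  x 1, ..., x k, D0. The relations x i f(D) = f(D - 1) x i for i \<le> k - 2 and
  x (k - 1) f(D) = f(D) x (k - 1) - f'(D) x k show that the module consists of the
  vectors f(D) v. The polynomial q = X^(p^2) - X^p satisfies q(X - 1) = q and q' = 0, so q(D)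
  commutes with L, hence acts as a scalar, and the dimension is at most p^2.

  The bound is attained by polynomials modulo q: D multiplies by X, x 1 maps f to f(X - 1),
  x (k - 1) acts as - d/dX, x k as the identity and everything else as 0. A polynomial f of
  least degree in a nonzero submodule has f(X - 1) = f and f' = 0. The latter makes f
  a polynomial g in X^p with g(X - 1) = g; if g is not constant, its roots are
  closed under translation by the prime field, so g has degree at least p and f degree at
  least p^2. Hence f is constant, and it generates everything.

  For the index, [y, z] = d(y) [D, z] - d(z) [D, y], where d is the D-coordinate, so the
  form (y, z) \<mapsto> \<chi>([y, z]) has rank 0 or 2.
\<close>

section \<open>Polynomials in an endomorphism\<close>

text \<open>The operator is total on the ambient type but constrained only on \<open>V\<close>, in
  line with \<open>lie_module\<close>. The same locale then serves for \<open>act D\<close>, for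
  q(D) and for restrictions to joint eigenspaces.\<close>

locale subspace_endo = vector_space scale
  for scale :: "'k::field \<Rightarrow> 'v::ab_group_add \<Rightarrow> 'v" +
  fixes V :: "'v set" and T :: "'v \<Rightarrow> 'v"
  assumes subspace_V: "subspace V"
    and T_closed: "v \<in> V \<Longrightarrow> T v \<in> V"
    and T_add: "v \<in> V \<Longrightarrow> w \<in> V \<Longrightarrow> T (v + w) = T v + T w"
    and T_scale: "v \<in> V \<Longrightarrow> T (scale c v) = scale c (T v)"
begin

lemma T_0 [simp]: "T 0 = 0"
  using T_scale[of 0 0] subspace_0[OF subspace_V] by simp

lemma T_diff: "v \<in> V \<Longrightarrow> w \<in> V \<Longrightarrow> T (v - w) = T v - T w"
  using T_add[of "v - w" w] subspace_diff[OF subspace_V, of v w] by simp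

lemmas V_closed = subspace_0[OF subspace_V] subspace_add[OF subspace_V]
  subspace_diff[OF subspace_V] subspace_scale[OF subspace_V] T_closed

text \<open>This is f(T) v, evaluated by Horner's scheme, so that induction over
  \<open>pCons\<close> is available for every law of the calculus.\<close>

definition poly_op :: "'k poly \<Rightarrow> 'v \<Rightarrow> 'v" where
  "poly_op f v = fold_coeffs (\<lambda>a w. scale a v + T w) f 0"

lemma poly_op_0 [simp]: "poly_op 0 v = 0"
  by (simp add: poly_op_def)

lemma poly_op_pCons [simp]: "poly_op (pCons a f) v = scale a v + T (poly_op f v)"
  by (cases "a = 0 \<and> f = 0") (auto simp: poly_op_def)

lemma poly_op_1 [simp]: "poly_op 1 v = v"
  by (simp add: one_pCons)

lemma poly_op_closed [simp]: "v \<in> V \<Longrightarrow> poly_op f v \<in> V"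
  by (induction f) (simp_all add: V_closed)

lemma poly_op_add: "v \<in> V \<Longrightarrow> poly_op (f + g) v = poly_op f v + poly_op g v"
  by (induction f g rule: poly_induct2) (simp_all add: T_add V_closed algebra_simps)

lemma poly_op_smult: "v \<in> V \<Longrightarrow> poly_op (smult c f) v = scale c (poly_op f v)"
  by (induction f) (simp_all add: T_scale V_closed algebra_simps)

lemma poly_op_diff: "v \<in> V \<Longrightarrow> poly_op (f - g) v = poly_op f v - poly_op g v"
  using poly_op_add[of v "f - g" g] by simp

lemma poly_op_sum: "v \<in> V \<Longrightarrow> poly_op (\<Sum>i\<in>I. f i) v = (\<Sum>i\<in>I. poly_op (f i) v)"
  by (induction I rule: infinite_finite_induct) (simp_all add: poly_op_add)

lemma poly_op_mult: "v \<in> V \<Longrightarrow> poly_op (f * g) v = poly_op f (poly_op g v)"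
  by (induction f) (simp_all add: poly_op_add poly_op_smult)

lemma poly_op_scale_right: "v \<in> V \<Longrightarrow> poly_op f (scale c v) = scale c (poly_op f v)"
  by (induction f) (simp_all add: T_scale V_closed algebra_simps)

lemma poly_op_add_right:
  "v \<in> V \<Longrightarrow> w \<in> V \<Longrightarrow> poly_op f (v + w) = poly_op f v + poly_op f w"
  by (induction f) (simp_all add: T_add V_closed algebra_simps)

lemma poly_op_monom_expand:
  assumes "v \<in> V" "degree f < n"
  shows "poly_op f v = (\<Sum>i<n. scale (coeff f i) (poly_op (monom 1 i) v))"
proof -
  have "f = (\<Sum>i<n. smult (coeff f i) (monom 1 i))"
    using assms(2) by (intro poly_eqI) (auto simp: coeff_sum smult_monom coeff_eq_0)
  then have "poly_op f v = poly_op (\<Sum>i<n. smult (coeff f i) (monom 1 i)) v"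
    by simp
  then show ?thesis
    using assms(1) by (simp add: poly_op_sum poly_op_smult del: smult_monom)
qed

text \<open>The vectors w, T w, ..., T^n w with n = \<open>card B\<close> all lie in
  \<open>span B\<close>, so they are dependent; the coefficients of a dependency are those of
  f.\<close>

lemma ex_annihilating_poly:
  assumes "finite B" "V \<subseteq> span B" "w \<in> V"
  shows "\<exists>f. f \<noteq> 0 \<and> poly_op f w = 0"
proof (rule ccontr)
  assume "\<nexists>f. f \<noteq> 0 \<and> poly_op f w = 0"
  then have ann: "f = 0" if "poly_op f w = 0" for f
    using that by blast
  define e where "e i = poly_op (monom 1 i) w" for i
  \<comment> \<open>An equality \<open>e i = e j\<close> would make X^i - X^j annihilate w.
    Injectivity gives the image \<open>card B + 1\<close> elements, one more than an independent
    subset of \<open>span B\<close> can have.\<close>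
  have inj: "inj_on e A" for A
  proof (rule inj_onI)
    fix i j assume "e i = e j"
    then have "poly_op (monom 1 i - monom 1 j) w = 0"
      using assms(3) by (simp add: e_def poly_op_diff)
    then have "monom (1::'k) i = monom 1 j"
      using ann by fastforce
    then show "i = j"
      by (metis degree_monom_eq zero_neq_one)
  qed
  have "independent (e ` {..card B})"
    unfolding dependent_finite[OF finite_imageI[OF finite_atMost]]
  proof clarify
    fix u i assume i: "i \<le> card B" "u (e i) \<noteq> 0"
      and eq: "(\<Sum>v\<in>e ` {..card B}. scale (u v) v) = 0"
    define f where "f = (\<Sum>j\<le>card B. smult (u (e j)) (monom 1 j))"
    have "poly_op f w = (\<Sum>j\<le>card B. scale (u (e j)) (e j))"
      unfolding f_def e_def using assms(3) by (simp add: poly_op_sum poly_op_smult del: smult_monom)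
    also have "\<dots> = 0"
      using eq by (simp add: sum.reindex[OF inj])
    finally have "coeff f i = 0"
      using ann coeff_0 by metis
    moreover have "coeff f i = u (e i)"
      using i(1) by (simp add: f_def coeff_sum smult_monom)
    ultimately show False
      using i(2) by simp
  qed
  moreover have "e ` {..card B} \<subseteq> span B"
    using assms(2,3) by (auto simp: e_def)
  ultimately have "card (e ` {..card B}) \<le> card B"
    using independent_span_bound[OF assms(1)] by blast
  then show False
    by (simp add: card_image[OF inj])
qed

text \<open>Take f of least degree with f(T) w = 0 and split off a root, f = (X - c) g. Minimality
  gives g(T) w nonzero, and T - c kills it. Algebraic closedness is passed as \<open>root\<close>
  because the locale works over any field.\<close>

lemma ex_eigenvector:
  assumes root: "\<And>f :: 'k poly. degree f > 0 \<Longrightarrow> \<exists>c. poly f c = 0"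
    and "finite B" "V \<subseteq> span B" "V \<noteq> {0}"
  shows "\<exists>v c. v \<in> V \<and> v \<noteq> 0 \<and> T v = scale c v"
proof -
  obtain w where w: "w \<in> V" "w \<noteq> 0"
    using assms(4) V_closed(1) by blast
  obtain f where "f \<noteq> 0 \<and> poly_op f w = 0"
      and min: "\<And>g. g \<noteq> 0 \<and> poly_op g w = 0 \<Longrightarrow> degree f \<le> degree g"
    using exists_least_iff[of "\<lambda>n. \<exists>f. (f \<noteq> 0 \<and> poly_op f w = 0) \<and> degree f = n"]
      ex_annihilating_poly[OF assms(2,3) w(1)] by (metis not_less)
  then have f: "f \<noteq> 0" "poly_op f w = 0" by auto
  have "degree f > 0"
  proof (rule ccontr)
    assume "\<not> degree f > 0"
    then obtain a where "f = [:a:]" using degree_eq_zeroE by blast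
    then show False using f w by simp
  qed
  then obtain c where "poly f c = 0"
    using root by blast
  then obtain g where g: "f = [:-c, 1:] * g"
    by (auto simp: poly_eq_0_iff_dvd)
  then have "g \<noteq> 0" using f by auto
  then have "degree f = Suc (degree g)"
    unfolding g by (subst degree_mult_eq) auto
  then have "poly_op g w \<noteq> 0"
    using min[of g] \<open>g \<noteq> 0\<close> by auto
  moreover have "T (poly_op g w) = scale c (poly_op g w)"
    using f(2) w(1) unfolding g by (simp add: poly_op_mult del: mult_pCons_left)
  ultimately show ?thesis
    using w(1) by (meson poly_op_closed)
qed

end

text \<open>Induction on the family: since the operators commute, the new one preserves the joint
  eigenspace \<open>E\<close> of the earlier ones, and so has an eigenvector in it.\<close>

lemma (in vector_space) commuting_family_common_eigenvector:
  fixes F :: "'i \<Rightarrow> 'b \<Rightarrow> 'b"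
  assumes root: "\<And>f :: 'a poly. degree f > 0 \<Longrightarrow> \<exists>c. poly f c = 0"
    and "finite B" "V \<subseteq> span B" "V \<noteq> {0}"
    and "finite I"
    and F: "\<And>i. i \<in> I \<Longrightarrow> subspace_endo scale V (F i)"
    and comm: "\<And>i j v. i \<in> I \<Longrightarrow> j \<in> I \<Longrightarrow> v \<in> V \<Longrightarrow> F i (F j v) = F j (F i v)"
    and "subspace V"
  shows "\<exists>v c. v \<in> V \<and> v \<noteq> 0 \<and> (\<forall>i\<in>I. F i v = scale (c i) v)"
  using \<open>finite I\<close> F comm
proof (induction I rule: finite_induct)
  case empty
  then show ?case
    using assms(4,8) subspace_0 by auto
next
  case (insert j I)
  then obtain v c where v: "v \<in> V" "v \<noteq> 0" "\<forall>i\<in>I. F i v = scale (c i) v"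
    by (metis insertCI)
  interpret j: subspace_endo scale V "F j"
    using insert.prems(1) by blast
  define E where "E = {w \<in> V. \<forall>i\<in>I. F i w = scale (c i) w}"
  have add: "F i (a + b) = F i a + F i b" and scl: "F i (scale r a) = scale r (F i a)"
    if "i \<in> I" "a \<in> V" "b \<in> V" for i a b r
    using insert.prems(1)[of i] that
    by (auto intro: subspace_endo.T_add subspace_endo.T_scale)
  have zero: "F i 0 = 0" if "i \<in> I" for i
    using insert.prems(1)[of i] that by (simp add: subspace_endo.T_0)
  have "subspace_endo scale E (F j)"
  proof unfold_locales
    show "subspace E"
      unfolding E_def subspace_def
      by (auto simp: j.V_closed add scl scale_right_distrib scale_left_commute zero)
    show "F j w \<in> E" if "w \<in> E" for w
      using that insert.prems(2)[of _ j w] by (auto simp: E_def j.V_closed j.T_scale)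
  qed (auto simp: E_def j.T_add j.T_scale)
  moreover have "E \<noteq> {0}" "E \<subseteq> span B"
    using v assms(3) by (auto simp: E_def)
  ultimately obtain w d where w: "w \<in> E" "w \<noteq> 0" "F j w = scale d w"
    using subspace_endo.ex_eigenvector[OF _ root \<open>finite B\<close>] by blast
  then have "w \<in> V \<and> w \<noteq> 0 \<and> (\<forall>i\<in>insert j I. F i w = scale ((c(j := d)) i) w)"
    using insert.hyps by (auto simp: E_def)
  then show ?case by blast
qed

section \<open>Polynomials in prime characteristic\<close>

text \<open>In prime characteristic p this is (X^p - X)^p, the p-th power of the Artin-Schreier
  polynomial. The base is invariant under X -> X - 1, and taking the p-th power makes the derivative
  vanish.\<close>

definition period_poly :: "'a::comm_ring_1 itself \<Rightarrow> 'a poly" where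
  "period_poly _ = monom 1 (CHAR('a)\<^sup>2) - monom 1 CHAR('a)"

abbreviation shift :: "'a::comm_ring_1 poly \<Rightarrow> 'a poly" where
  "shift f \<equiv> pcompose f [:-1, 1:]"

lemma pcompose_power: "pcompose (f ^ n) g = pcompose f g ^ n"
  for f g :: "'a::comm_ring_1 poly"
  by (induction n) (simp_all add: pcompose_1 pcompose_mult)

lemma degree_diff_eq_left:
  "degree g < degree f \<Longrightarrow> degree (f - g) = degree f"
  for f g :: "'a::ab_group_add poly"
  using degree_add_eq_left[of "- g" f] by simp

lemma shift_monom_CHAR_power:
  assumes "prime CHAR('a::comm_ring_1)"
  shows "shift (monom (1::'a) (CHAR('a) ^ n)) = monom 1 (CHAR('a) ^ n) - 1"
proof -
  let ?q = "CHAR('a) ^ n"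
  \<comment> \<open>Expanding X as (X - 1) + 1, rather than expanding X - 1, avoids the sign
    (-1)^q.\<close>
  have "[:0, 1::'a:] ^ ?q = ([:-1, 1:] + 1) ^ ?q"
    by (simp add: one_pCons)
  also have "\<dots> = [:-1, 1:] ^ ?q + 1"
    by (subst freshmans_dream'[where n = n]) (use assms in simp_all)
  finally have "[:-1, 1::'a:] ^ ?q = [:0, 1:] ^ ?q - 1"
    by simp
  then show ?thesis
    by (simp add: monom_altdef pcompose_power pcompose_pCons)
qed

text \<open>Both monomials lose the same constant 1, which cancels in the difference.\<close>

lemma shift_period_poly:
  assumes "prime CHAR('a::comm_ring_1)"
  shows "shift (period_poly TYPE('a)) = period_poly TYPE('a)"
  using shift_monom_CHAR_power[OF assms, of 1] shift_monom_CHAR_power[OF assms, of 2]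
  by (simp add: period_poly_def pcompose_diff)

lemma pderiv_period_poly: "pderiv (period_poly TYPE('a::idom)) = 0"
  by (simp add: period_poly_def pderiv_diff pderiv_monom of_nat_CHAR power2_eq_square)

lemma degree_period_poly:
  assumes "prime CHAR('a::comm_ring_1)"
  shows "degree (period_poly TYPE('a)) = CHAR('a)\<^sup>2"
proof -
  have "CHAR('a) < CHAR('a)\<^sup>2"
    using prime_gt_1_nat[OF assms] by (simp add: power2_eq_square)
  then show ?thesis
    unfolding period_poly_def by (simp add: degree_diff_eq_left degree_monom_eq)
qed

text \<open>Each coefficient satisfies j * f_j = 0, so f_j = 0 unless p divides j; only powers of
  X^p remain.\<close>

lemma pderiv_zero_imp_pcompose_monom:
  fixes f :: "'a::idom poly"
  assumes "pderiv f = 0" "CHAR('a) > 0"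
  shows "\<exists>g. f = pcompose g (monom 1 CHAR('a))"
proof -
  let ?p = "CHAR('a)"
  \<comment> \<open>The range is generous: since p > 0, every n with p * n at most
    \<open>degree f\<close> is itself at most \<open>degree f\<close>.\<close>
  define g where "g = (\<Sum>n\<le>degree f. monom (coeff f (?p * n)) n)"
  have monom: "pcompose (monom c n) (monom 1 ?p) = monom c (?p * n)" for c :: 'a and n
    by (simp add: monom_altdef[of c n] pcompose_smult pcompose_power pcompose_pCons
        monom_power smult_monom)
  have "coeff f j = coeff (pcompose g (monom 1 ?p)) j" for j
  proof -
    have "coeff (pcompose g (monom 1 ?p)) j
        = (\<Sum>n\<le>degree f. if ?p * n = j then coeff f j else 0)"
      unfolding g_def by (auto simp: pcompose_sum monom coeff_sum intro!: sum.cong)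
    also have "\<dots> = coeff f j"
    proof (cases "?p dvd j")
      case True
      then obtain m where m: "j = ?p * m" by blast
      then have "(\<Sum>n\<le>degree f. if ?p * n = j then coeff f j else 0)
          = (\<Sum>n\<le>degree f. if n = m then coeff f j else 0)"
        using assms(2) by simp
      also have "\<dots> = coeff f j"
      proof (cases "m \<le> degree f")
        case False
        moreover have "m \<le> ?p * m"
          using assms(2) by simp
        ultimately have "degree f < j"
          using m by linarith
        then show ?thesis by (simp add: coeff_eq_0)
      qed simp
      finally show ?thesis .
    next
      case False
      then obtain i where i: "j = Suc i"
        by (metis dvd_0_right not0_implies_Suc)
      have "of_nat j * coeff f j = 0"
        using assms(1) coeff_pderiv[of f i] i by simp
      then have "coeff f j = 0"
        using False by (simp add: of_nat_eq_0_iff_char_dvd)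
      then show ?thesis by (simp cong: if_cong)
    qed
    finally show ?thesis by simp
  qed
  then show ?thesis
    by (intro exI[of _ g] poly_eqI)
qed

text \<open>From g(s - 1) = g(s), the root r produces the roots r, r - 1, r - 2, ..., and the first
  \<open>CHAR('a)\<close> of them are distinct.\<close>

lemma shift_invariant_imp_degree_ge:
  fixes g :: "'a::idom poly"
  assumes "shift g = g" "g \<noteq> 0" "poly g r = 0"
  shows "CHAR('a) \<le> degree g"
proof -
  let ?e = "\<lambda>i. r - of_nat i :: 'a"
  have "poly g (?e i) = 0" for i
  proof (induction i)
    case (Suc i)
    have "poly g (?e (Suc i)) = poly (shift g) (?e i)"
      by (simp add: poly_pcompose algebra_simps)
    then show ?case
      using Suc assms(1) by simp
  qed (use assms in simp)
  then have sub: "?e ` {..<CHAR('a)} \<subseteq> {s. poly g s = 0}"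
    by auto
  \<comment> \<open>The order of i and j makes the natural subtraction j - i genuine; the other case
    follows by symmetry.\<close>
  have eq: "i = j" if "i \<le> j" "j < CHAR('a)" "?e i = ?e j" for i j
  proof -
    have "of_nat (j - i) = (0 :: 'a)"
      using that by (simp add: of_nat_diff)
    then have "CHAR('a) dvd j - i"
      by (simp add: of_nat_eq_0_iff_char_dvd)
    then show ?thesis
      using that by (auto dest: dvd_imp_le)
  qed
  have "inj_on ?e {..<CHAR('a)}"
  proof (rule inj_onI)
    fix i j assume "i \<in> {..<CHAR('a)}" "j \<in> {..<CHAR('a)}" "?e i = ?e j"
    then show "i = j"
      using eq[of i j] eq[OF _ _ sym, of j i] linear[of i j] by blast
  qed
  then have "CHAR('a) = card (?e ` {..<CHAR('a)})"
    by (simp add: card_image)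
  also have "\<dots> \<le> card {s. poly g s = 0}"
    using sub poly_roots_finite[OF assms(2)] by (rule card_mono[rotated])
  also have "\<dots> \<le> degree g"
    using card_poly_roots_bound[OF assms(2)] .
  finally show ?thesis .
qed

text \<open>Write f = g(X^p). As (X - 1)^p = X^p - 1, shifting f amounts to shifting g, and
  substituting X^p is injective, so g is shift invariant. A nonconstant g has a root, hence degree
  at least p, which forces degree at least p^2 on f.\<close>

lemma shift_invariant_pderiv_zero_imp_const:
  fixes f :: "'a::alg_closed_field poly"
  assumes "shift f = f" "pderiv f = 0" "degree f < CHAR('a)\<^sup>2" "prime CHAR('a)"
  shows "degree f = 0"
proof (rule ccontr)
  let ?p = "CHAR('a)"
  let ?Y = "monom 1 ?p :: 'a poly"
  assume pos: "degree f \<noteq> 0"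
  have p: "?p > 0"
    using assms(4) by (simp add: prime_gt_0_nat)
  obtain g where g: "f = pcompose g ?Y"
    using pderiv_zero_imp_pcompose_monom[OF assms(2) p] by blast
  have deg: "degree f = degree g * ?p"
    by (simp add: g degree_pcompose degree_monom_eq)
  have "[:- 1 :: 'a:] = - 1"
    by (simp add: one_pCons)
  then have "pcompose [:-1, 1:] ?Y = shift ?Y"
    using shift_monom_CHAR_power[OF assms(4), of 1] by (simp add: pcompose_pCons)
  then have "pcompose (shift g) ?Y = pcompose g (shift ?Y)"
    by (simp only: pcompose_assoc[symmetric])
  also have "\<dots> = pcompose g ?Y"
    using assms(1) by (simp add: g pcompose_assoc)
  finally have "pcompose (shift g - g) ?Y = 0"
    by (simp add: pcompose_diff)
  then have "shift g - g = 0"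
    by (rule pcompose_eq_0) (use p in \<open>simp add: degree_monom_eq\<close>)
  then have shift: "shift g = g"
    by simp
  have "degree g > 0"
    using pos deg by simp
  then obtain r where "poly g r = 0"
    using alg_closed_imp_poly_has_root by blast
  moreover have "g \<noteq> 0"
    using \<open>degree g > 0\<close> by auto
  ultimately have "?p \<le> degree g"
    using shift_invariant_imp_degree_ge[OF shift] by blast
  then show False
    using assms(3) deg p by (simp add: power2_eq_square)
qed

text \<open>Since X - 1 is monic of degree 1, f(X - 1) and f share degree and leading coefficient.
  This and \<open>degree_pderiv_less\<close> drive the descent to a constant in
  \<open>simple_model\<close>.\<close>

lemma degree_shift_diff_less:
  fixes f :: "'a::idom poly"
  assumes "degree f > 0"
  shows "degree (shift f - f) < degree f"
proof -
  have d: "degree (shift f) = degree f"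
    by (simp add: degree_pcompose)
  have "coeff (shift f) (degree f) = lead_coeff f"
    using lead_coeff_comp[of "[:-1, 1:]" f] d by simp
  then show ?thesis
    using eq_zero_or_degree_less[of "shift f - f" "degree f"] degree_diff_le[of "shift f" "degree f" f]
      d assms by auto
qed

lemma degree_pderiv_less:
  fixes f :: "'a::idom poly"
  assumes "degree f > 0"
  shows "degree (pderiv f) < degree f"
  using assms by (intro degree_lessI) (auto simp: coeff_pderiv coeff_eq_0)

text \<open>The shift maps multiples of an invariant q to multiples of q and preserves degrees, so
  it carries remainders to remainders. Thus it descends to the quotient by q.\<close>

lemma shift_mod:
  fixes f q :: "'a::field poly"
  assumes "shift q = q"
  shows "shift (f mod q) = shift f mod q"
proof (cases "q = 0")
  case False
  have "shift f = shift (q * (f div q) + f mod q)"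
    by (simp only: mult_div_mod_eq)
  also have "\<dots> = q * shift (f div q) + shift (f mod q)"
    using assms by (simp only: pcompose_add pcompose_mult)
  finally have "shift f mod q = shift (f mod q) mod q"
    by simp
  moreover have "shift (f mod q) = 0 \<or> degree (shift (f mod q)) < degree q"
    using degree_mod_less[OF False, of f] by (auto simp: degree_pcompose)
  ultimately show ?thesis
    by (auto simp: mod_poly_less)
qed simp

text \<open>With q' = 0 the Leibniz rule gives (q g)' = q g', so differentiation preserves the ideal
  of q and descends to the quotient.\<close>

lemma pderiv_mod:
  fixes f q :: "'a::field poly"
  assumes "pderiv q = 0"
  shows "pderiv (f mod q) = pderiv f mod q"
proof (cases "q = 0")
  case False
  have "pderiv f = pderiv (q * (f div q) + f mod q)"
    by (simp only: mult_div_mod_eq)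
  also have "\<dots> = q * pderiv (f div q) + pderiv (f mod q)"
    by (simp only: pderiv_add pderiv_mult assms mult_zero_right add_0_right)
  finally have "pderiv f mod q = pderiv (f mod q) mod q"
    by simp
  moreover have "pderiv (f mod q) = 0 \<or> degree (pderiv (f mod q)) < degree q"
  proof (cases "degree (f mod q) = 0")
    case True
    then show ?thesis by (metis degree_eq_zeroE pderiv_singleton)
  next
    case deg: False
    then have "f mod q \<noteq> 0" by auto
    then show ?thesis
      using degree_mod_less[OF False, of f] degree_pderiv_less[of "f mod q"] deg by auto
  qed
  ultimately show ?thesis
    by (auto simp: mod_poly_less)
qed simp

lemma shift_pderiv: "pderiv (shift f) = shift (pderiv f)"
  for f :: "'a::idom poly"
  by (simp add: pderiv_pcompose pderiv_pCons)

section \<open>Coefficient sequences\<close>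

lemma sum_fun_apply: "sum f A x = (\<Sum>a\<in>A. f a x)"
  for f :: "'a \<Rightarrow> 'b \<Rightarrow> 'c::comm_monoid_add"
  by (induction A rule: infinite_finite_induct) simp_all

interpretation coord_space: vector_space coord_scale
  by (rule vector_space_coord_scale)

lemma coeff_add_fun: "coeff (f + g) = coeff f + coeff g"
  by (simp add: fun_eq_iff)

lemma coeff_diff_fun: "coeff (f - g) = coeff f - coeff g"
  by (simp add: fun_eq_iff)

lemma coeff_smult_fun: "coeff (smult c f) = coord_scale c (coeff f)"
  by (simp add: fun_eq_iff coord_scale_def)

lemma coeff_sum_fun: "coeff (sum f A) = (\<Sum>a\<in>A. coeff (f a))"
  by (simp add: fun_eq_iff coeff_sum sum_fun_apply)

lemma coeff_eq_0_iff: "coeff f = 0 \<longleftrightarrow> f = 0"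
  by (simp add: fun_eq_iff poly_eq_iff)

text \<open>Modules have to live in the space of sequences, so a polynomial of degree below n is
  represented by its coefficients: \<open>coeff\<close> maps onto this space, with inverse
  \<open>seq_poly n\<close>.\<close>

definition seq_space :: "nat \<Rightarrow> (nat \<Rightarrow> 'a::zero) set" where
  "seq_space n = {v. \<forall>i\<ge>n. v i = 0}"

definition seq_poly :: "nat \<Rightarrow> (nat \<Rightarrow> 'a::field) \<Rightarrow> 'a poly" where
  "seq_poly n v = (\<Sum>i<n. monom (v i) i)"

lemma coeff_seq_poly: "coeff (seq_poly n v) i = (if i < n then v i else 0)"
  by (simp add: seq_poly_def coeff_sum)

lemma coeff_seq_poly_fun: "v \<in> seq_space n \<Longrightarrow> coeff (seq_poly n v) = v"
  by (auto simp: fun_eq_iff coeff_seq_poly seq_space_def)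

lemma degree_seq_poly: "n > 0 \<Longrightarrow> degree (seq_poly n v) < n"
  by (rule degree_lessI) (auto simp: coeff_seq_poly)

lemma coeff_mem_seq_space: "degree f < n \<Longrightarrow> coeff f \<in> seq_space n"
  by (auto simp: seq_space_def coeff_eq_0)

lemma seq_poly_coeff: "degree f < n \<Longrightarrow> seq_poly n (coeff f) = f"
  by (intro poly_eqI) (auto simp: coeff_seq_poly coeff_eq_0)

lemma seq_poly_add: "seq_poly n (v + w) = seq_poly n v + seq_poly n w"
  by (intro poly_eqI) (simp add: coeff_seq_poly)

lemma seq_poly_scale: "seq_poly n (coord_scale c v) = smult c (seq_poly n v)"
  by (intro poly_eqI) (simp add: coeff_seq_poly coord_scale_def)

lemma subspace_seq_space: "coord_space.subspace (seq_space n)"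
  by (simp add: coord_space.subspace_def seq_space_def coord_scale_def)

lemma seq_space_expand:
  assumes "v \<in> seq_space n"
  shows "v = (\<Sum>i<n. coord_scale (v i) (coeff (monom 1 i)))"
proof -
  have "v = coeff (\<Sum>i<n. smult (v i) (monom 1 i))"
    using coeff_seq_poly_fun[OF assms] by (simp add: seq_poly_def smult_monom)
  then show ?thesis
    by (simp add: coeff_sum_fun coeff_smult_fun del: smult_monom)
qed

lemma span_monoms:
  "coord_space.span ((\<lambda>i. coeff (monom (1::'a::field) i)) ` {..<n}) = seq_space n"
    (is "coord_space.span ?B = _")
proof
  show "coord_space.span ?B \<subseteq> seq_space n"
    by (rule coord_space.span_minimal[OF _ subspace_seq_space]) (auto simp: seq_space_def)
  show "seq_space n \<subseteq> coord_space.span ?B"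
  proof
    fix v :: "nat \<Rightarrow> 'a" assume "v \<in> seq_space n"
    then have "v = (\<Sum>i<n. coord_scale (v i) (coeff (monom 1 i)))"
      by (rule seq_space_expand)
    moreover have "\<dots> \<in> coord_space.span ?B"
      by (auto intro!: coord_space.span_sum coord_space.span_scale intro: coord_space.span_base)
    ultimately show "v \<in> coord_space.span ?B"
      by simp
  qed
qed

lemma dim_seq_space: "coord_space.dim (seq_space n :: (nat \<Rightarrow> 'a::field) set) = n"
proof -
  let ?e = "\<lambda>i. coeff (monom (1::'a) i)"
  have inj: "inj_on ?e {..<n}"
    by (rule inj_onI) (metis coeff_inject degree_monom_eq zero_neq_one)
  have "coord_space.independent (?e ` {..<n})"
    unfolding coord_space.dependent_finite[OF finite_imageI[OF finite_lessThan]]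
  proof clarify
    fix u i assume i: "i < n" "u (?e i) \<noteq> 0"
      and eq: "(\<Sum>v\<in>?e ` {..<n}. coord_scale (u v) v) = 0"
    have "(\<Sum>j<n. coord_scale (u (?e j)) (?e j)) = 0"
      using eq by (simp only: sum.reindex[OF inj] o_def)
    \<comment> \<open>Position i of the vanishing combination isolates the coefficient of the i-th
      unit sequence.\<close>
    then have "0 = (\<Sum>j<n. coord_scale (u (?e j)) (?e j)) i"
      by (simp only: zero_fun_apply)
    also have "\<dots> = (\<Sum>j<n. if j = i then u (?e i) else 0)"
      unfolding sum_fun_apply by (intro sum.cong) (simp_all add: coord_scale_def)
    finally show False
      using i by simp
  qed
  then have "coord_space.dim (seq_space n :: (nat \<Rightarrow> 'a) set) = card (?e ` {..<n})"
    by (metis coord_space.dim_eq_card coord_space.span_eq_iff span_monoms subspace_seq_space)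
  then show ?thesis
    by (simp add: card_image[OF inj])
qed

section \<open>The Lie algebra\<close>

text \<open>Independence of a set cannot detect coincidences among the listed elements, hence the
  separate distinctness assumptions.\<close>

locale example_algebra = lie_algebra scale bracket
  for scale :: "'k::alg_closed_field \<Rightarrow> 'l::ab_group_add \<Rightarrow> 'l"
    and bracket :: "'l \<Rightarrow> 'l \<Rightarrow> 'l" +
  fixes k :: nat and x :: "nat \<Rightarrow> 'l" and D0 D :: 'l
  assumes char_pos: "CHAR('k) > 0" and k_ge: "k \<ge> 3"
    and inj_x: "inj_on x {1..k}" and D0_notin: "D0 \<notin> x ` {1..k}"
    and D_notin: "D \<notin> insert D0 (x ` {1..k})"
    and indep: "independent (x ` {1..k} \<union> {D0, D})"
    and spanning: "span (x ` {1..k} \<union> {D0, D}) = UNIV"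
    and bracket_D0: "bracket D0 y = 0"
    and bracket_x_x: "i \<in> {1..k} \<Longrightarrow> j \<in> {1..k} \<Longrightarrow> bracket (x i) (x j) = 0"
    and bracket_D_x: "i \<in> {1..k - 2} \<Longrightarrow> bracket D (x i) = x i"
    and bracket_D_x_pred: "bracket D (x (k - 1)) = x k"
    and bracket_D_x_last: "bracket D (x k) = 0"
begin

lemma prime_char: "prime CHAR('k)"
  by (rule prime_CHAR_semidom[OF char_pos])

text \<open>Separates the behaviours of ad D: eigenvalue 1, then the top and the bottom of a
  nilpotent Jordan block.\<close>

lemma x_index_cases:
  assumes "i \<in> {1..k}"
  obtains "i \<in> {1..k - 2}" | "i = k - 1" | "i = k"
  using assms by fastforce

lemma bracket_0_left [simp]: "bracket 0 y = 0"
  using bracket_scale_left[of 0 0 y] by simp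

lemma bracket_0_right [simp]: "bracket y 0 = 0"
  using bracket_scale_right[of y 0 0] by simp

lemma bracket_anti: "bracket y z = - bracket z y"
  using bracket_self[of "y + z"] unfolding bracket_add_left bracket_add_right
  by (simp add: bracket_self eq_neg_iff_add_eq_0 add.commute)

lemma bracket_D0_right: "bracket y D0 = 0"
  using bracket_anti[of y D0] bracket_D0 by simp

lemma basis_induct [case_names x D0 D 0 add scale]:
  assumes "\<And>i. i \<in> {1..k} \<Longrightarrow> P (x i)" "P D0" "P D" "P 0"
    and "\<And>y z. P y \<Longrightarrow> P z \<Longrightarrow> P (y + z)" "\<And>c y. P y \<Longrightarrow> P (scale c y)"
  shows "P y"
proof -
  have "y \<in> span (x ` {1..k} \<union> {D0, D})"
    using spanning by simp
  then show ?thesis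
    by (induction rule: span_induct_alt) (use assms in auto)
qed

section \<open>Upper bound for the dimension of a simple module\<close>

lemma dim_simple_module_le:
  assumes simple: "simple_lie_module scale bracket scaleV V act"
    and fin: "finite B" "V \<subseteq> module.span scaleV B"
  shows "vector_space.dim scaleV V \<le> CHAR('k)\<^sup>2"
proof -
  interpret S: simple_lie_module scale bracket scaleV V act by (fact simple)
  have endo: "subspace_endo scaleV V (act y)" for y
    by unfold_locales (auto simp: S.subspace_V S.act_closed S.act_add_right S.act_scale_right)
  interpret T: subspace_endo scaleV V "act D" by (fact endo)
  have act_0: "act 0 v = 0" if "v \<in> V" for v
    using S.act_scale_left[of v 0 0] that by simp
  have root: "\<exists>c. poly f c = 0" if "degree f > 0" for f :: "'k poly"
    using alg_closed_imp_poly_has_root[OF that] .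
  have swap: "act a (act b v) = act b (act a v) - act (bracket b a) v" if "v \<in> V" for a b v
    using S.act_bracket[OF that, of b a] by simp

  \<comment> \<open>The bracket relation reads a D = (D - 1) a, so moving a past each factor D
    replaces it by D - 1.\<close>
  have act_shift: "act a (T.poly_op f v) = T.poly_op (shift f) (act a v)"
    if "bracket D a = a" "v \<in> V" for a f v
  proof (induction f)
    case (pCons c f)
    have "act a (T.poly_op (pCons c f) v)
        = scaleV c (act a v) + (act D (act a (T.poly_op f v)) - act a (T.poly_op f v))"
      using that by (simp add: S.act_add_right S.act_scale_right T.V_closed S.act_closed swap[of _ a])
    also have "\<dots> = T.poly_op ([:c:] + [:-1, 1:] * shift f) (act a v)"
      unfolding pCons.IH using that
      by (simp add: T.poly_op_add T.poly_op_mult S.act_closed del: mult_pCons_left)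
    finally show ?case
      by (simp add: pcompose_pCons)
  qed (use that in \<open>simp add: subspace_endo.T_0[OF endo]\<close>)

  have act_comm: "act a (T.poly_op f v) = T.poly_op f (act a v)"
    if "bracket D a = 0" "v \<in> V" for a f v
    using that
    by (induction f) (simp_all add: subspace_endo.T_0[OF endo] S.act_add_right S.act_scale_right
        T.V_closed S.act_closed swap[of _ a] act_0)

  \<comment> \<open>Here a D = D a - b and b commutes with D, so each factor D that a passes
    contributes one term, as in the Leibniz rule.\<close>
  have act_deriv: "act a (T.poly_op f v) = T.poly_op f (act a v) - T.poly_op (pderiv f) (act b v)"
    if ab: "bracket D a = b" "bracket D b = 0" and v: "v \<in> V" for a b f v
  proof (induction f)
    case (pCons c f)
    have "act a (T.poly_op (pCons c f) v)
        = scaleV c (act a v) + (act D (act a (T.poly_op f v)) - T.poly_op f (act b v))"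
      using ab v by (simp add: S.act_add_right S.act_scale_right T.V_closed S.act_closed
          swap[of _ a] act_comm)
    also have "\<dots> = T.poly_op (pCons c f) (act a v)
        - T.poly_op (f + pCons 0 (pderiv f)) (act b v)"
      unfolding pCons.IH using v by (simp add: T.T_diff T.poly_op_add S.act_closed)
    finally show ?case
      by (simp add: pderiv_pCons)
  qed (simp add: subspace_endo.T_0[OF endo])

  \<comment> \<open>All basis elements except D; they span an abelian ideal, whose action therefore
    has a common eigenvector.\<close>
  define A where "A = insert D0 (x ` {1..k})"
  have "bracket a b = 0" if "a \<in> A" "b \<in> A" for a b
    using that bracket_x_x by (auto simp: A_def bracket_D0 bracket_D0_right)
  then have "act a (act b v) = act b (act a v)" if "a \<in> A" "b \<in> A" "v \<in> V" for a b v
    using swap[of v a b] that by (simp add: act_0)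
  moreover have "finite A"
    by (simp add: A_def)
  ultimately obtain v c where v: "v \<in> V" "v \<noteq> 0"
    and eig: "\<And>a. a \<in> A \<Longrightarrow> act a v = scaleV (c a) v"
    using S.M.commuting_family_common_eigenvector[OF root fin S.nonzero, of A act] endo
      S.subspace_V by metis
  \<comment> \<open>The cyclic subspace k[D] v. The commutation rules push every basis element
    through to v, where it acts by a scalar, so \<open>W\<close> is a submodule.\<close>
  define W where "W = range (\<lambda>f. T.poly_op f v)"
  have W: "T.poly_op f v \<in> W" for f
    by (simp add: W_def)
  have subW: "S.M.subspace W"
    unfolding S.M.subspace_def
  proof (intro conjI ballI allI)
    show "0 \<in> W" using W[of 0] by simp
    fix u w r assume "u \<in> W" "w \<in> W"
    then obtain f g where "u = T.poly_op f v" "w = T.poly_op g v"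
      by (auto simp: W_def)
    then show "u + w \<in> W" "scaleV r u \<in> W"
      using W[of "f + g"] W[of "smult r f"] v by (simp_all add: T.poly_op_add T.poly_op_smult)
  qed
  have W_V: "W \<subseteq> V"
    using v by (auto simp: W_def)
  have W_eig: "T.poly_op f (scaleV r v) \<in> W" for f r
    using v W S.M.subspace_scale[OF subW] by (simp add: T.poly_op_scale_right)
  have "act y w \<in> W" if wW: "w \<in> W" for y w
  proof (induction y rule: basis_induct)
    case (x i)
    obtain f where w: "w = T.poly_op f v"
      using wW by (auto simp: W_def)
    have A: "x i \<in> A" "x k \<in> A"
      using x k_ge by (auto simp: A_def)
    show ?case
      using x
    proof (cases rule: x_index_cases)
      case 1
      then show ?thesis
        unfolding w using act_shift[OF bracket_D_x v(1)] eig A W_eig by simp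
    next
      case 2
      then show ?thesis
        unfolding w using act_deriv[OF bracket_D_x_pred bracket_D_x_last v(1)] eig A W_eig
          S.M.subspace_diff[OF subW] by simp
    next
      case 3
      then show ?thesis
        unfolding w using act_comm[OF bracket_D_x_last v(1)] eig A W_eig by simp
    qed
  next
    case D0
    then show ?case
      using wW act_comm[OF bracket_D0_right v(1)] eig[of D0] W_eig
      by (auto simp: W_def A_def)
  next
    case D
    obtain f where w: "w = T.poly_op f v"
      using wW by (auto simp: W_def)
    then show ?case
      using W[of "pCons 0 f"] by simp
  next
    case 0
    then show ?case using wW W_V S.M.subspace_0[OF subW] act_0 by auto
  next
    case (add y z)
    then show ?case using wW W_V S.M.subspace_add[OF subW] S.act_add_left by auto
  next
    case (scale r y)
    then show ?case using wW W_V S.M.subspace_scale[OF subW] S.act_scale_left by auto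
  qed
  moreover have "W \<noteq> {0}"
    using W[of 1] v by auto
  ultimately have WV: "W = V"
    using S.submodule_trivial[OF subW W_V] by blast

  define q where "q = period_poly TYPE('k)"
  interpret Z: subspace_endo scaleV V "T.poly_op q"
    by unfold_locales
      (auto simp: S.subspace_V T.poly_op_add_right T.poly_op_scale_right)
  \<comment> \<open>Shift invariance of q handles the eigenvectors of ad D, and q' = 0 removes the
    extra term for \<open>x (k - 1)\<close>.\<close>
  have central: "act y (T.poly_op q w) = T.poly_op q (act y w)" if "w \<in> V" for y w
  proof (induction y rule: basis_induct)
    case (x i)
    then show ?case
    proof (cases rule: x_index_cases)
      case 1
      then show ?thesis
        using act_shift[OF bracket_D_x that] shift_period_poly[OF prime_char] by (simp add: q_def)
    next
      case 2
      then show ?thesis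
        using act_deriv[OF bracket_D_x_pred bracket_D_x_last that]
        by (simp add: q_def pderiv_period_poly)
    next
      case 3
      then show ?thesis
        using act_comm[OF bracket_D_x_last that] by simp
    qed
  next
    case D0
    then show ?case
      using act_comm[OF bracket_D0_right that] .
  next
    case D
    \<comment> \<open>D is itself the value of the polynomial X, so it commutes with q(D) because
      polynomials do.\<close>
    have "T.poly_op ([:0, 1:] * q) w = T.poly_op (q * [:0, 1:]) w"
      by (simp only: mult.commute)
    then show ?case
      using that by (simp add: T.poly_op_mult del: mult_pCons_left mult_pCons_right)
  qed (use that in \<open>simp_all add: act_0 S.act_add_left S.act_scale_left T.poly_op_add_right
        T.poly_op_scale_right S.act_closed\<close>)
  obtain w0 r where w0: "w0 \<in> V" "w0 \<noteq> 0" "T.poly_op q w0 = scaleV r w0"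
    using Z.ex_eigenvector[OF root fin S.nonzero] by blast
  \<comment> \<open>Schur's argument: an eigenspace of an operator commuting with L is a submodule,
    and this one contains \<open>w0\<close>.\<close>
  define E where "E = {w \<in> V. T.poly_op q w = scaleV r w}"
  have "S.M.subspace E"
    unfolding S.M.subspace_def E_def
    by (auto simp: T.V_closed T.poly_op_add_right T.poly_op_scale_right S.M.scale_right_distrib
        mult.commute)
  moreover have "act y w \<in> E" if "w \<in> E" for y w
    using that by (auto simp: E_def S.act_closed S.act_scale_right simp flip: central)
  ultimately have "E = V"
    using S.submodule_trivial[of E] w0 by (auto simp: E_def)
  define h where "h = q - [:r:]"
  have h0: "T.poly_op h w = 0" if "w \<in> V" for w
    using that \<open>E = V\<close> by (auto simp: h_def T.poly_op_diff E_def)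
  have deg_h: "degree h = CHAR('k)\<^sup>2"
    unfolding h_def q_def using degree_period_poly[OF prime_char] char_pos
    by (subst degree_diff_eq_left) auto
  then have "h \<noteq> 0"
    using char_pos by auto
  define b where "b i = T.poly_op (monom 1 i) v" for i
  have "V \<subseteq> S.M.span (b ` {..<CHAR('k)\<^sup>2})"
  proof
    fix w assume "w \<in> V"
    then obtain f where f: "w = T.poly_op f v"
      using WV by (auto simp: W_def)
    \<comment> \<open>Since h(D) = 0 on V, f may be replaced by its remainder modulo h, of degree
      below p^2; hence the first p^2 powers of D applied to v span V.\<close>
    have "T.poly_op (h * g + m) v = T.poly_op m v" for g m
      using v by (simp add: T.poly_op_add T.poly_op_mult h0)
    from this[of "f div h" "f mod h"] have "w = T.poly_op (f mod h) v"
      using f by simp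
    moreover have "degree (f mod h) < CHAR('k)\<^sup>2"
      using degree_mod_less[OF \<open>h \<noteq> 0\<close>, of f] deg_h char_pos by auto
    ultimately have "w = (\<Sum>i<CHAR('k)\<^sup>2. scaleV (coeff (f mod h) i) (b i))"
      using T.poly_op_monom_expand[OF v(1)] by (simp add: b_def)
    then show "w \<in> S.M.span (b ` {..<CHAR('k)\<^sup>2})"
      by (auto intro!: S.M.span_sum S.M.span_scale intro: S.M.span_base)
  qed
  then have "S.M.dim V \<le> card (b ` {..<CHAR('k)\<^sup>2})"
    by (rule S.M.dim_le_card) simp
  also have "\<dots> \<le> CHAR('k)\<^sup>2"
    using card_image_le[of "{..<CHAR('k)\<^sup>2}" b] by simp
  finally show ?thesis .
qed

section \<open>Coordinates and a closed formula for the bracket\<close>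

definition coord :: "'l \<Rightarrow> 'l \<Rightarrow> 'k" where
  "coord b y = representation (x ` {1..k} \<union> {D0, D}) y b"

lemma coord_add [simp]: "coord b (y + z) = coord b y + coord b z"
  by (simp only: coord_def representation_add[OF indep] spanning UNIV_I)

lemma coord_scale [simp]: "coord b (scale c y) = c * coord b y"
  by (simp only: coord_def representation_scale[OF indep] spanning UNIV_I)

lemma coord_0 [simp]: "coord b 0 = 0"
  using coord_scale[of b 0 0] by simp

lemma coord_diff [simp]: "coord b (y - z) = coord b y - coord b z"
  using coord_add[of b "y - z" z] by simp

lemma coord_basis:
  assumes "a \<in> x ` {1..k} \<union> {D0, D}"
  shows "coord b a = (if a = b then 1 else 0)"
  unfolding coord_def using representation_basis[OF indep assms] by auto

lemma coord_x:
  assumes "i \<in> {1..k}" "j \<in> {1..k}"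
  shows "coord (x i) (x j) = (if i = j then 1 else 0)"
  using coord_basis[of "x j" "x i"] assms inj_on_eq_iff[OF inj_x] by auto

lemma coord_D [simp]: "coord D D = 1"
  by (simp add: coord_basis)

lemma coord_x_D: "i \<in> {1..k} \<Longrightarrow> coord (x i) D = 0"
  and coord_x_D0: "i \<in> {1..k} \<Longrightarrow> coord (x i) D0 = 0"
  and coord_D_x: "i \<in> {1..k} \<Longrightarrow> coord D (x i) = 0"
  and coord_D_D0: "coord D D0 = 0"
  using D_notin D0_notin by (auto simp: coord_basis)

lemma coord_D_bracket_D: "coord D (bracket D y) = 0"
proof (induction y rule: basis_induct)
  case (x i)
  then show ?case
    using coord_D_x[OF x] coord_D_x[of k] k_ge
    by (cases rule: x_index_cases)
      (simp_all add: bracket_D_x bracket_D_x_pred bracket_D_x_last del: One_nat_def)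
qed (simp_all add: bracket_add_right bracket_scale_right bracket_self bracket_D0_right)

text \<open>The elements with D-coordinate 0 form an abelian ideal complementing the line of D, so
  only brackets with D survive. Both sides are linear in each argument and are compared on the
  basis.\<close>

lemma bracket_eq:
  "bracket y z = scale (coord D y) (bracket D z) - scale (coord D z) (bracket D y)"
proof (induction y rule: basis_induct)
  case (x i)
  have "bracket (x i) z = - scale (coord D z) (bracket D (x i))"
  proof (induction z rule: basis_induct)
    case (x j)
    then show ?case
      using \<open>i \<in> {1..k}\<close> by (simp add: bracket_x_x coord_D_x)
  next
    case D
    show ?case
      using bracket_anti[of "x i" D] by simp
  qed (simp_all add: bracket_add_right bracket_scale_right bracket_D0_right coord_D_D0
      algebra_simps)
  then show ?case
    using x by (simp add: coord_D_x)
qed (simp_all add: bracket_add_left bracket_scale_left bracket_add_right bracket_scale_right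
    bracket_D0 bracket_D0_right bracket_self coord_D_D0 scale_left_distrib scale_right_distrib
    scale_right_diff_distrib add_diff_add mult.commute)

section \<open>The index\<close>

lemma card_basis: "card (x ` {1..k} \<union> {D0, D}) = k + 2"
proof -
  have "D \<notin> x ` {1..k}" "D \<noteq> D0"
    using D_notin by auto
  then show ?thesis
    using D0_notin card_image[OF inj_x] by simp
qed

lemma dim_UNIV: "dim UNIV = k + 2"
  using dim_eq_card[of "x ` {1..k} \<union> {D0, D}" UNIV] indep spanning card_basis by simp

text \<open>Let d be the D-coordinate and \<open>\<psi>\<close> the functional w ->
  \<open>\<chi> (bracket D w)\<close>. The form \<open>\<chi> (bracket y z)\<close> is the wedge of
  d and \<open>\<psi>\<close>. If \<open>\<psi>\<close> is nonzero, it is independent of d because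
  it vanishes at D, and the radical is their common kernel, of codimension 2.\<close>

lemma dim_stabiliser:
  assumes "\<chi> \<in> dual_space"
  shows "dim (stabiliser \<chi>) = (if \<forall>w. \<chi> (bracket D w) = 0 then k + 2 else k)"
proof -
  interpret \<chi>: Vector_Spaces.linear scale "(*)" \<chi>
    using assms by (simp add: dual_space_def)
  define \<psi> where "\<psi> w = \<chi> (bracket D w)" for w
  have \<psi>_add: "\<psi> (y + z) = \<psi> y + \<psi> z" and \<psi>_scale: "\<psi> (scale c y) = c * \<psi> y"
    and \<psi>_D: "\<psi> D = 0" for y z c
    by (simp_all add: \<psi>_def bracket_add_right bracket_scale_right bracket_self
        \<chi>.add \<chi>.scale \<chi>.zero)
  have \<psi>_diff: "\<psi> (y - z) = \<psi> y - \<psi> z" for y z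
    using \<psi>_add[of "y - z" z] by simp
  have \<chi>_bracket: "\<chi> (bracket y z) = coord D y * \<psi> z - coord D z * \<psi> y" for y z
    by (subst bracket_eq) (simp add: \<chi>.diff \<chi>.scale \<psi>_def)
  show ?thesis
  proof (cases "\<forall>w. \<chi> (bracket D w) = 0")
    case True
    then have "\<psi> w = 0" for w
      by (simp add: \<psi>_def)
    then have "stabiliser \<chi> = UNIV"
      by (simp add: stabiliser_def \<chi>_bracket)
    then show ?thesis
      using True dim_UNIV by simp
  next
    case False
    then obtain w where w: "\<psi> w \<noteq> 0"
      by (auto simp: \<psi>_def)
    \<comment> \<open>Removing the D-component leaves the value of \<open>\<psi>\<close> unchanged,
      as \<open>\<psi>\<close> vanishes at D. Thus D, e are dual to d,
      \<open>\<psi>\<close>.\<close>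
    define e where "e = scale (1 / \<psi> w) (w - scale (coord D w) D)"
    have e: "\<psi> e = 1" "coord D e = 0"
      using w by (simp_all add: e_def \<psi>_diff \<psi>_scale \<psi>_D)
    have stab: "stabiliser \<chi> = {y. coord D y = 0 \<and> \<psi> y = 0}" (is "_ = ?S")
    proof (intro equalityI subsetI)
      fix y assume y: "y \<in> stabiliser \<chi>"
      then have "coord D y * \<psi> z = coord D z * \<psi> y" for z
        by (simp add: stabiliser_def \<chi>_bracket)
      \<comment> \<open>Taking z = D yields \<open>\<psi> y = 0\<close>, and z = e yields
        \<open>coord D y = 0\<close>.\<close>
      from this[of D] this[of e] show "y \<in> ?S"
        by (simp add: e \<psi>_D)
    qed (simp add: stabiliser_def \<chi>_bracket)
    have "subspace ?S"
      using \<psi>_scale[of 0 0] by (auto simp: subspace_def \<psi>_add \<psi>_scale)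
    obtain B where B: "B \<subseteq> ?S" "independent B" "?S \<subseteq> span B" "card B = dim ?S"
      using basis_exists by blast
    then have "finite B"
      using independent_span_bound[of "x ` {1..k} \<union> {D0, D}" B] spanning by auto
    have span_B: "span B = ?S"
      using B \<open>subspace ?S\<close> span_minimal by blast
    have "e \<notin> span B"
      using e by (simp add: span_B)
    have "subspace {y. coord D y = 0}"
      by (simp add: subspace_def)
    moreover have "insert e B \<subseteq> {y. coord D y = 0}"
      using e B(1) by auto
    ultimately have "span (insert e B) \<subseteq> {y. coord D y = 0}"
      by (metis span_minimal)
    then have "D \<notin> span (insert e B)"
      by (auto dest: subsetD[of _ _ D])
    have indep': "independent (insert D (insert e B))"
      using B(2) \<open>e \<notin> span B\<close> \<open>D \<notin> span (insert e B)\<close> by (simp add: independent_insertI)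
    have "y \<in> span (insert D (insert e B))" for y
    proof -
      let ?S' = "span (insert D (insert e B))"
      \<comment> \<open>Subtracting the components along D and e projects y onto the common kernel,
        which \<open>B\<close> spans.\<close>
      define s where "s = y - scale (coord D y) D - scale (\<psi> y) e"
      have "s \<in> span B"
        by (simp add: s_def span_B \<psi>_diff \<psi>_scale e \<psi>_D)
      then have "s \<in> ?S'"
        using span_mono[of B "insert D (insert e B)"] by blast
      moreover have "D \<in> ?S'" "e \<in> ?S'"
        by (simp_all add: span_base)
      ultimately have "s + scale (coord D y) D + scale (\<psi> y) e \<in> ?S'"
        by (intro span_add span_scale)
      then show ?thesis
        by (simp add: s_def)
    qed
    then have "dim UNIV = card (insert D (insert e B))"
      using dim_eq_card[OF _ indep', of UNIV] by auto
    also have "\<dots> = card B + 2"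
    proof -
      have "e \<notin> B" "D \<notin> insert e B"
        using \<open>e \<notin> span B\<close> \<open>D \<notin> span (insert e B)\<close> by (metis span_base)+
      then show ?thesis
        using \<open>finite B\<close> by simp
    qed
    finally show ?thesis
      using False B(4) stab dim_UNIV by simp
  qed
qed

text \<open>The coordinate of \<open>x k\<close> takes the value 1 at [D, x (k - 1)] = x k, so the
  smaller of the two possible dimensions k and k + 2 occurs.\<close>

lemma ind_eq: "ind = k"
proof -
  have "Vector_Spaces.linear scale (*) (coord (x k))"
    by unfold_locales (simp_all add: algebra_simps)
  then have \<chi>: "coord (x k) \<in> dual_space"
    by (simp add: dual_space_def)
  have "coord (x k) (bracket D (x (k - 1))) \<noteq> 0"
    using k_ge by (simp add: bracket_D_x_pred coord_x del: One_nat_def)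
  then have "dim (stabiliser (coord (x k))) = k"
    using dim_stabiliser[OF \<chi>] by auto
  then have "k \<in> (\<lambda>\<chi>. dim (stabiliser \<chi>)) ` dual_space"
    using \<chi> by (metis image_eqI)
  moreover have "(\<lambda>\<chi>. dim (stabiliser \<chi>)) ` dual_space \<subseteq> {k, k + 2}"
    using dim_stabiliser by auto
  ultimately show ?thesis
    unfolding ind_def by (intro Min_eqI) (auto intro: finite_subset)
qed

section \<open>A simple module of dimension p^2\<close>

definition mult_X :: "'k poly \<Rightarrow> 'k poly" where
  "mult_X f = pCons 0 f mod period_poly TYPE('k)"

text \<open>The quotient by q is modelled on remainders of degree below p^2. Coordinates make the
  action linear in y by construction. The minus sign matches [D, x (k - 1)] = x k, because (X f)' -
  X f' = f.\<close>

definition model_op :: "'l \<Rightarrow> 'k poly \<Rightarrow> 'k poly" where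
  "model_op y f = smult (coord (x 1) y) (shift f) - smult (coord (x (k - 1)) y) (pderiv f)
    + smult (coord (x k) y) f + smult (coord D y) (mult_X f)"

lemma char_sq_pos: "CHAR('k)\<^sup>2 > 0"
  using char_pos by simp

lemma degree_mult_X: "degree (mult_X f) < CHAR('k)\<^sup>2"
  using degree_mod_less[of "period_poly TYPE('k)" "pCons 0 f"] degree_period_poly[OF prime_char]
    char_sq_pos by (fastforce simp: mult_X_def)

lemma mult_X_add: "mult_X (f + g) = mult_X f + mult_X g"
  using poly_mod_add_left[of "pCons 0 f" "pCons 0 g"] by (simp add: mult_X_def)

lemma mult_X_diff: "mult_X (f - g) = mult_X f - mult_X g"
  using mult_X_add[of "f - g" g] by simp

lemma mult_X_smult: "mult_X (smult c f) = smult c (mult_X f)"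
  using mod_smult_left[of c "pCons 0 f"] by (simp add: mult_X_def)

lemma mod_period_poly: "degree f < CHAR('k)\<^sup>2 \<Longrightarrow> f mod period_poly TYPE('k) = f"
  using degree_period_poly[OF prime_char] by (simp add: mod_poly_less)

text \<open>The identity (X f)(X - 1) = (X - 1) f(X - 1) read modulo q; it encodes [D, x 1] = x
  1.\<close>

lemma shift_mult_X:
  assumes "degree f < CHAR('k)\<^sup>2"
  shows "shift (mult_X f) = mult_X (shift f) - shift f"
proof -
  have "shift (mult_X f) = (pCons 0 (shift f) - shift f) mod period_poly TYPE('k)"
    by (simp add: mult_X_def shift_mod shift_period_poly[OF prime_char] pcompose_pCons)
  then show ?thesis
    using assms by (simp add: mult_X_def poly_mod_diff_left mod_period_poly degree_pcompose)
qed

text \<open>The Leibniz rule for X f, valid modulo q because q' = 0; the degree bound lets f be its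
  own remainder.\<close>

lemma pderiv_mult_X:
  assumes "degree f < CHAR('k)\<^sup>2"
  shows "pderiv (mult_X f) = f + mult_X (pderiv f)"
  using assms
  by (simp add: mult_X_def pderiv_mod pderiv_period_poly pderiv_pCons poly_mod_add_left
      mod_period_poly)

lemma degree_model_op:
  assumes "degree f < CHAR('k)\<^sup>2"
  shows "degree (model_op y f) < CHAR('k)\<^sup>2"
proof -
  have "degree (pderiv f) < CHAR('k)\<^sup>2"
    using assms degree_pderiv_less[of f] char_pos
    by (cases "degree f = 0") (auto elim!: degree_eq_zeroE simp: pderiv_pCons)
  then show ?thesis
    unfolding model_op_def using assms degree_mult_X char_pos
    by (intro degree_add_less degree_diff_less)
      (auto intro: le_less_trans[OF degree_smult_le] simp: degree_pcompose)
qed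

lemma model_op_add_left: "model_op (y + z) f = model_op y f + model_op z f"
  by (simp add: model_op_def smult_add_left)

lemma model_op_scale_left: "model_op (scale c y) f = smult c (model_op y f)"
  by (simp add: model_op_def smult_add_right smult_diff_right)

lemma model_op_add: "model_op y (f + g) = model_op y f + model_op y g"
  by (simp add: model_op_def smult_add_right pcompose_add pderiv_add mult_X_add)

lemma model_op_smult: "model_op y (smult c f) = smult c (model_op y f)"
  by (simp add: model_op_def smult_add_right smult_diff_right pcompose_smult pderiv_smult
      mult_X_smult mult.commute)

lemma coord_bracket_D:
  shows "coord (x 1) (bracket D y) = coord (x 1) y"
    and "coord (x (k - 1)) (bracket D y) = 0"
    and "coord (x k) (bracket D y) = coord (x (k - 1)) y"
proof -
  have "coord (x 1) (bracket D y) = coord (x 1) y \<and> coord (x (k - 1)) (bracket D y) = 0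
    \<and> coord (x k) (bracket D y) = coord (x (k - 1)) y"
  proof (induction y rule: basis_induct)
    case (x i)
    then show ?case
    proof (cases rule: x_index_cases)
      case 1
      then show ?thesis
        using x k_ge by (simp add: bracket_D_x coord_x) linarith
    next
      case 2
      \<comment> \<open>Here \<open>k \<ge> 3\<close> enters: \<open>x 1\<close> must differ from
        \<open>x (k - 1)\<close>.\<close>
      moreover have "k - 1 \<noteq> 1" "k - 1 \<noteq> k"
        using k_ge by auto
      ultimately show ?thesis
        using x k_ge by (simp add: bracket_D_x_pred coord_x del: One_nat_def)
    next
      case 3
      then show ?thesis
        using x k_ge by (simp add: bracket_D_x_last coord_x del: One_nat_def)
    qed
  next
    case D0
    then show ?case
      using k_ge by (simp add: bracket_D0_right coord_x_D0)
  next
    case D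
    then show ?case
      using k_ge by (simp add: bracket_self coord_x_D)
  qed (simp_all add: bracket_add_right bracket_scale_right)
  then show "coord (x 1) (bracket D y) = coord (x 1) y"
    "coord (x (k - 1)) (bracket D y) = 0"
    "coord (x k) (bracket D y) = coord (x (k - 1)) y"
    by simp_all
qed

lemma coord_bracket:
  "coord b (bracket y z) = coord D y * coord b (bracket D z) - coord D z * coord b (bracket D y)"
  by (subst bracket_eq) (simp only: coord_diff coord_scale)

text \<open>The shift, the derivative and the identity commute with one another, so the only nonzero
  commutators are those with \<open>mult_X\<close>, given by \<open>shift_mult_X\<close> and
  \<open>pderiv_mult_X\<close>. They match the coordinates of the bracket.\<close>

lemma model_op_bracket:
  assumes "degree f < CHAR('k)\<^sup>2"
  shows "model_op (bracket y z) f = model_op y (model_op z f) - model_op z (model_op y f)"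
proof -
  have "coord (x 1) (bracket y z) = coord D y * coord (x 1) z - coord D z * coord (x 1) y"
    "coord (x (k - 1)) (bracket y z) = 0"
    "coord (x k) (bracket y z)
      = coord D y * coord (x (k - 1)) z - coord D z * coord (x (k - 1)) y"
    "coord D (bracket y z) = 0"
    by (simp_all only: coord_bracket[of _ y z] coord_bracket_D coord_D_bracket_D mult_zero_right
        diff_zero)
  note coords = this
  show ?thesis
    unfolding model_op_def coords pcompose_add pcompose_diff pcompose_smult pderiv_add pderiv_diff
      pderiv_smult mult_X_add mult_X_diff mult_X_smult shift_mult_X[OF assms]
      pderiv_mult_X[OF assms] shift_pderiv
    by (rule poly_eqI) (simp add: algebra_simps del: One_nat_def)
qed

definition model_act :: "'l \<Rightarrow> (nat \<Rightarrow> 'k) \<Rightarrow> (nat \<Rightarrow> 'k)" where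
  "model_act y v = coeff (model_op y (seq_poly (CHAR('k)\<^sup>2) v))"

lemma model_act_coeff: "degree f < CHAR('k)\<^sup>2 \<Longrightarrow> model_act y (coeff f) = coeff (model_op y f)"
  by (simp add: model_act_def seq_poly_coeff)

lemma model_op_basis:
  shows "model_op (x 1) f = shift f"
    and "model_op (x (k - 1)) f = - pderiv f"
    and "model_op D f = mult_X f"
proof -
  have "k - 1 \<noteq> 1" "k \<noteq> k - 1" "k \<noteq> 1"
    using k_ge by auto
  then show "model_op (x 1) f = shift f" "model_op (x (k - 1)) f = - pderiv f"
    "model_op D f = mult_X f"
    using k_ge by (simp_all add: model_op_def coord_x coord_x_D coord_D_x del: One_nat_def)
qed

lemma simple_model: "simple_lie_module scale bracket coord_scale (seq_space (CHAR('k)\<^sup>2)) model_act"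
proof -
  let ?V = "seq_space (CHAR('k)\<^sup>2) :: (nat \<Rightarrow> 'k) set"
  have "lie_module scale bracket coord_scale ?V model_act"
  proof unfold_locales
    show "coord_space.subspace ?V" by (rule subspace_seq_space)
    fix v w :: "nat \<Rightarrow> 'k" and y z c assume v: "v \<in> ?V"
    note deg = degree_seq_poly[OF char_sq_pos]
    show "model_act y v \<in> ?V"
      by (simp add: model_act_def coeff_mem_seq_space degree_model_op deg)
    show "model_act (y + z) v = model_act y v + model_act z v"
      by (simp add: model_act_def model_op_add_left coeff_add_fun)
    show "model_act (scale c y) v = coord_scale c (model_act y v)"
      by (simp add: model_act_def model_op_scale_left coeff_smult_fun)
    show "model_act y (v + w) = model_act y v + model_act y w"
      by (simp add: model_act_def model_op_add seq_poly_add coeff_add_fun)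
    show "model_act y (coord_scale c v) = coord_scale c (model_act y v)"
      by (simp add: model_act_def model_op_smult seq_poly_scale coeff_smult_fun)
    show "model_act (bracket y z) v = model_act y (model_act z v) - model_act z (model_act y v)"
      by (simp add: model_act_def[of _ v] model_act_coeff degree_model_op deg model_op_bracket
          coeff_diff_fun)
  qed
  moreover have "?V \<noteq> {0}"
  proof
    assume "?V = {0}"
    moreover have "coeff (1 :: 'k poly) \<in> ?V"
      using char_sq_pos by (intro coeff_mem_seq_space) simp
    ultimately show False
      by (simp add: coeff_eq_0_iff)
  qed
  moreover have "W = {0} \<or> W = ?V"
    if W: "coord_space.subspace W" "W \<subseteq> ?V" and inv: "\<And>y w. w \<in> W \<Longrightarrow> model_act y w \<in> W"
    for W
  proof (cases "W = {0}")
    case False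
    \<comment> \<open>\<open>P\<close> describes the nonzero polynomials of the submodule; one of
      least degree is chosen and shown to be constant.\<close>
    define P where "P f \<longleftrightarrow> f \<noteq> 0 \<and> degree f < CHAR('k)\<^sup>2 \<and> coeff f \<in> W" for f :: "'k poly"
    obtain w where w: "w \<in> W" "w \<noteq> 0"
      using False coord_space.subspace_0[OF W(1)] by blast
    then have "coeff (seq_poly (CHAR('k)\<^sup>2) w) = w"
      using W(2) coeff_seq_poly_fun by blast
    then have "P (seq_poly (CHAR('k)\<^sup>2) w)"
      using w degree_seq_poly[OF char_sq_pos] by (auto simp: P_def coeff_eq_0_iff)
    then obtain f where "P f" and min: "\<And>g. P g \<Longrightarrow> degree f \<le> degree g"
      using exists_least_iff[of "\<lambda>n. \<exists>f. P f \<and> degree f = n"] by (metis not_less)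
    then have f: "f \<noteq> 0" "degree f < CHAR('k)\<^sup>2" "coeff f \<in> W"
      by (auto simp: P_def)
    have zero: "g = 0" if "coeff g \<in> W" "degree g < degree f" for g
      using min[of g] that f(2) by (auto simp: P_def)
    have op: "coeff (model_op y f) \<in> W" for y
      using inv[OF f(3)] f(2) by (simp add: model_act_coeff)
    have "degree f = 0"
    proof (rule ccontr)
      assume "degree f \<noteq> 0"
      \<comment> \<open>Both this difference and the derivative stay in \<open>W\<close> and have
        degree below that of f, so minimality makes them vanish.\<close>
      moreover have "coeff (shift f - f) \<in> W"
        using op[of "x 1"] f(3) coord_space.subspace_diff[OF W(1)]
        by (simp add: model_op_basis coeff_diff_fun del: One_nat_def)
      moreover have "coeff (- pderiv f) \<in> W"
        using op[of "x (k - 1)"] by (simp add: model_op_basis del: One_nat_def)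
      ultimately have "shift f - f = 0" "- pderiv f = 0"
        using zero[of "shift f - f"] zero[of "- pderiv f"] degree_shift_diff_less[of f]
          degree_pderiv_less[of f] by auto
      then show False
        using shift_invariant_pderiv_zero_imp_const[of f] f(2) prime_char \<open>degree f \<noteq> 0\<close> by simp
    qed
    then obtain a where a: "f = [:a:]"
      by (rule degree_eq_zeroE)
    have monom: "coeff (monom 1 i) \<in> W" if "i < CHAR('k)\<^sup>2" for i
      using that
    proof (induction i)
      case 0
      have "monom 1 0 = smult (1 / a) f"
        using a f(1) by (simp add: monom_0)
      then show ?case
        using f(3) coord_space.subspace_scale[OF W(1)] by (simp only: coeff_smult_fun)
    next
      case (Suc i)
      \<comment> \<open>As \<open>Suc i\<close> is below the degree of q, the product X * X^i is its
        own remainder.\<close>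
      then have "model_op D (monom 1 i) = monom 1 (Suc i)"
        by (simp add: model_op_basis mult_X_def mod_period_poly degree_monom_eq flip: monom_Suc)
      then show ?case
        using Suc inv[of "coeff (monom 1 i)" D]
        by (simp add: model_act_coeff degree_monom_eq del: coeff_monom)
    qed
    have "?V \<subseteq> W"
    proof
      fix v :: "nat \<Rightarrow> 'k" assume "v \<in> ?V"
      then have "v = (\<Sum>i<CHAR('k)\<^sup>2. coord_scale (v i) (coeff (monom 1 i)))"
        by (rule seq_space_expand)
      moreover have "\<dots> \<in> W"
        using monom by (intro coord_space.subspace_sum coord_space.subspace_scale W(1)) auto
      ultimately show "v \<in> W"
        by simp
    qed
    then show ?thesis
      using W(2) by blast
  qed simp
  ultimately show ?thesis
    by (simp add: simple_lie_module_def simple_lie_module_axioms_def)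
qed

text \<open>The upper bound also makes the set of dimensions finite, so that \<open>Max\<close> is
  meaningful; the model attains the bound.\<close>

lemma max_simple_dim_eq: "max_simple_dim scale bracket = CHAR('k)\<^sup>2"
proof -
  have "CHAR('k)\<^sup>2 \<in> simple_module_dims scale bracket"
    unfolding simple_module_dims_def using simple_model dim_seq_space span_monoms
    by (metis (mono_tags, lifting) finite_imageI finite_lessThan mem_Collect_eq)
  moreover have le: "n \<le> CHAR('k)\<^sup>2" if "n \<in> simple_module_dims scale bracket" for n
    using that dim_simple_module_le unfolding simple_module_dims_def by blast
  moreover have "finite (simple_module_dims scale bracket)"
    using le by (meson finite_nat_set_iff_bounded_le)
  ultimately show ?thesis
    unfolding max_simple_dim_def by (intro Max_eqI) auto
qed

end

theorem mainTheorem1: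
  fixes scale :: "'k::alg_closed_field \<Rightarrow> 'l::ab_group_add \<Rightarrow> 'l"
    and bracket :: "'l \<Rightarrow> 'l \<Rightarrow> 'l"
    and p k :: nat
    and x :: "nat \<Rightarrow> 'l"
    and D0 D :: 'l
  assumes "p = CHAR('k)" and "p > 0" and "k \<ge> 3"
    and "lie_algebra scale bracket"
    and "inj_on x {1..k}" and "D0 \<notin> x ` {1..k}" and "D \<notin> insert D0 (x ` {1..k})"
    and "\<not> module.dependent scale (x ` {1..k} \<union> {D0, D})"
    and "module.span scale (x ` {1..k} \<union> {D0, D}) = UNIV"
    and "\<And>y. bracket D0 y = 0"
    and "\<And>i j. i \<in> {1..k} \<Longrightarrow> j \<in> {1..k} \<Longrightarrow> bracket (x i) (x j) = 0"
    and "\<And>i. i \<in> {1..k - 2} \<Longrightarrow> bracket D (x i) = x i"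
    and "bracket D (x (k - 1)) = x k"
    and "bracket D (x k) = 0"
  shows "p\<^sup>2 dvd max_simple_dim scale bracket \<and>
         lie_algebra.ind scale bracket = k \<and>
         real (max_simple_dim scale bracket) \<noteq>
           real p powr (1 / 2 * (real (vector_space.dim scale (UNIV :: 'l set))
                                 - real (lie_algebra.ind scale bracket)))"
proof -
  interpret example_algebra scale bracket k x D0 D
    using assms by (intro example_algebra.intro example_algebra_axioms.intro) simp_all
  have "p > 1"
    using prime_char assms(1) prime_gt_1_nat by simp
  \<comment> \<open>The exponent in the claim is (k + 2 - k) / 2 = 1, so the comparison is between
    p^2 and p.\<close>
  then have "real (p\<^sup>2) \<noteq> real p"
    by (simp add: power2_eq_square)
  then show ?thesis
    using \<open>p > 1\<close> by (simp add: max_simple_dim_eq ind_eq dim_UNIV assms(1)[symmetric])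
qed

end
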